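(* Let $t$ be a positive integer and $Q_t=\{1,3,5,\dots,2t-1\}\setminus\{t,t+1\}$. A self-conjugate partition $\lambda$ belongs to $\mathcal{DS}(t)$ if and only if $MD(\lambda)$ satisfies all of the following: (i) $MD(\lambda)\subseteq Q_t$; (ii) if $h_1,h_2\in MD(\lambda)$ and $h_1>h_2$, then $h_1-h_2\ge4$; (iii) if $h_1,h_2\in MD(\lambda)$, then $h_1+h_2\ne 2t$ and $h_1+h_2\ne 2t+2$.
   Context: Hook length of box $(i,j)$ of a Young diagram: number of boxes to its right in row $i$, plus number below it in column $j$, plus one. A partition is a $t$-core if no hook length is divisible by $t$; a $(t,t+1)$-core if it is both a $t$-core and a $(t+1)$-core. Self-conjugate: Young diagram symmetric about the main diagonal. $s(\lambda)$ is the largest $s$ such that $\lambda$ has at least $s$ parts $\ge s$. $MD(\lambda)$ is the set of hook lengths of the main-diagonal boxes $(i,i)$, $1\le i\le s(\lambda)$ ($MD(\emptyset)=\emptyset$). $\mathcal{DS}(t)$ is the set of self-conjugate $(t,t+1)$-core partitions whose first $s(\lambda)$ parts are pairwise distinct, including the empty partition. *)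

theory Defs
  imports Main
begin

definition is_partition :: "nat list \<Rightarrow> bool" where
  "is_partition p \<longleftrightarrow> sorted_wrt (\<ge>) p \<and> 0 \<notin> set p"

text \<open>Boxes are pairs (row, column), both counted from 1; list positions count from 0.\<close>

definition young :: "nat list \<Rightarrow> (nat \<times> nat) set" where
  "young p = {(i, j). 1 \<le> i \<and> i \<le> length p \<and> 1 \<le> j \<and> j \<le> p ! (i - 1)}"

definition hook :: "nat list \<Rightarrow> nat \<Rightarrow> nat \<Rightarrow> nat" where
  "hook p i j =
     card {j'. j < j' \<and> (i, j') \<in> young p} + card {i'. i < i' \<and> (i', j) \<in> young p} + 1"

definition is_core :: "nat \<Rightarrow> nat list \<Rightarrow> bool" where
  "is_core t p \<longleftrightarrow> (\<forall>(i, j) \<in> young p. \<not> t dvd hook p i j)"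

definition self_conjugate :: "nat list \<Rightarrow> bool" where
  "self_conjugate p \<longleftrightarrow> (\<forall>i j. (i, j) \<in> young p \<longleftrightarrow> (j, i) \<in> young p)"

definition durfee :: "nat list \<Rightarrow> nat" where
  "durfee p = Max {s. s \<le> length (filter (\<lambda>x. s \<le> x) p)}"

definition MD :: "nat list \<Rightarrow> nat set" where
  "MD p = {hook p i i | i. 1 \<le> i \<and> i \<le> durfee p}"

definition DS :: "nat \<Rightarrow> nat list set" where
  "DS t = {p. is_partition p \<and> self_conjugate p \<and> is_core t p \<and> is_core (t + 1) p
              \<and> distinct (take (durfee p) p)}"

definition Q :: "nat \<Rightarrow> nat set" where
  "Q t = {h. odd h \<and> 1 \<le> h \<and> h \<le> 2 * t - 1} - {t, t + 1}"

text \<open>The set defining \<^const>\<open>durfee\<close> is finite and nonempty, so its maximum is attained.\<close>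

lemma durfee_set_finite: "finite {s. s \<le> length (filter (\<lambda>x. s \<le> x) p)}"
  by (rule finite_subset[of _ "{..length p}"])
     (auto intro: order_trans[OF _ length_filter_le])

lemma durfee_Nil: "durfee [] = 0"
  by (simp add: durfee_def)

lemma MD_Nil: "MD [] = {}"
  by (auto simp: MD_def durfee_Nil)

lemma Nil_in_DS: "[] \<in> DS t"
  by (auto simp: DS_def is_partition_def self_conjugate_def is_core_def young_def)

end

theory Submission
  imports Defs
begin

text \<open>
  Encode a self-conjugate partition by the odd integers \<open>b i = 2 (\<lambda>\<^sub>i - i) + 1\<close>, \<open>i \<ge> 1\<close>. This
  sequence is strictly decreasing, its positive terms are exactly the main diagonal hook lengths,
  and the hook length of the box \<open>(i, j)\<close> is \<open>(b i + b j) / 2\<close>, where \<open>(i, j)\<close> is a box if and only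
  if \<open>b i + b j > 0\<close>. Moreover every odd \<open>x\<close> satisfies \<open>x = b i\<close> or \<open>-x = b i\<close> for some \<open>i\<close>.
  Distinctness of the first \<open>s(\<lambda>)\<close> parts says that diagonal hooks differ by at least 4.
  In a \<open>t\<close>-core a diagonal hook \<open>h > 2 t\<close> forces the diagonal hook \<open>h - 2 t\<close>, since otherwise
  \<open>2 t - h\<close> is some \<open>b j\<close> and \<open>t\<close> is a hook length. Hence in a \<open>(t, t + 1)\<close>-core \<open>h > 2 t + 2\<close>
  would produce two diagonal hooks at distance 2, and \<open>h = 2 t + 1\<close> would produce the diagonal
  hook 1 with \<open>h + 1 = 2 (t + 1)\<close>.
\<close>

section \<open>Bead coding of a self-conjugate partition\<close>

definition part :: "nat list \<Rightarrow> nat \<Rightarrow> nat" where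
  "part p i = (if 1 \<le> i \<and> i \<le> length p then p ! (i - 1) else 0)"

text \<open>This is the Maya diagram coordinate \<open>part p i - i + 1/2\<close>, doubled to stay
  in the integers. As \<open>part\<close> is 0 past the last row, the sequence is infinite.\<close>

definition bead :: "nat list \<Rightarrow> nat \<Rightarrow> int" where
  "bead p i = 2 * (int (part p i) - int i) + 1"

lemma young_iff: "(i, j) \<in> young p \<longleftrightarrow> 1 \<le> i \<and> 1 \<le> j \<and> j \<le> part p i"
  by (auto simp: young_def part_def)

lemma self_conjugate_part:
  assumes "self_conjugate p" "1 \<le> i" "1 \<le> j"
  shows "j \<le> part p i \<longleftrightarrow> i \<le> part p j"
  using assms unfolding self_conjugate_def young_iff by blast

lemma part_antimono:
  assumes "is_partition p" "1 \<le> i" "i \<le> j"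
  shows "part p j \<le> part p i"
proof (cases "i = j \<or> length p < j")
  case False
  then have "i - 1 < j - 1" "j - 1 < length p" using assms by auto
  then have "p ! (j - 1) \<le> p ! (i - 1)"
    using assms(1) unfolding is_partition_def sorted_wrt_iff_nth_less by blast
  then show ?thesis using assms False by (simp add: part_def)
qed (auto simp: part_def)

lemma bead_less_iff:
  assumes "is_partition p" "1 \<le> i" "1 \<le> j"
  shows "bead p j < bead p i \<longleftrightarrow> i < j"
  using part_antimono[OF assms(1), of i j] part_antimono[OF assms(1), of j i] assms
  by (cases i j rule: linorder_cases) (auto simp: bead_def)

lemma odd_bead: "odd (bead p i)"
  by (simp add: bead_def)

text \<open>Half the sum is \<open>(part p i - j) + (part p j - i) + 1\<close> over the integers. By
  symmetry both brackets are nonnegative at a box and both are negative elsewhere.\<close>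

lemma bead_sum_pos_iff:
  assumes "self_conjugate p" "1 \<le> i" "1 \<le> j"
  shows "0 < bead p i + bead p j \<longleftrightarrow> (i, j) \<in> young p"
  using self_conjugate_part[OF assms] assms by (auto simp: bead_def young_iff)

lemma hook_eq:
  assumes "self_conjugate p" "(i, j) \<in> young p"
  shows "2 * int (hook p i j) = bead p i + bead p j"
proof -
  have ij: "1 \<le> i" "1 \<le> j" "j \<le> part p i" using assms(2) by (auto simp: young_iff)
  have ji: "i \<le> part p j" using self_conjugate_part[OF assms(1) ij(1,2)] ij(3) by simp
  have "{j'. j < j' \<and> (i, j') \<in> young p} = {j<..part p i}"
    using ij by (auto simp: young_iff)
  moreover have "{i'. i < i' \<and> (i', j) \<in> young p} = {i<..part p j}"
    using ij self_conjugate_part[OF assms(1) _ ij(2)] by (auto simp: young_iff)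
  ultimately have "hook p i j = (part p i - j) + (part p j - i) + 1"
    by (simp add: hook_def)
  then show ?thesis using ij(3) ji by (simp add: bead_def)
qed

lemma is_core_iff_bead:
  assumes "self_conjugate p"
  shows "is_core t p \<longleftrightarrow>
    (\<forall>i\<ge>1. \<forall>j\<ge>1. 0 < bead p i + bead p j \<longrightarrow> \<not> 2 * int t dvd bead p i + bead p j)"
proof -
  have dvd: "t dvd hook p i j \<longleftrightarrow> 2 * int t dvd bead p i + bead p j" if "(i, j) \<in> young p" for i j
    using hook_eq[OF assms that, symmetric] by simp
  show ?thesis
    unfolding is_core_def
    using dvd bead_sum_pos_iff[OF assms] by (fastforce simp: young_iff)
qed

section \<open>Durfee square and diagonal hooks\<close>

text \<open>Since the parts decrease weakly, those of size at least \<open>s\<close> form an initial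
  segment, so only row \<open>s\<close> needs testing.\<close>

lemma le_length_filter_iff:
  assumes "is_partition p" "1 \<le> s"
  shows "s \<le> length (filter (\<lambda>x. s \<le> x) p) \<longleftrightarrow> s \<le> part p s"
proof -
  let ?A = "{i. i < length p \<and> s \<le> p ! i}"
  have len: "length (filter (\<lambda>x. s \<le> x) p) = card ?A"
    by (rule length_filter_conv_card)
  have nth: "p ! i = part p (Suc i)" if "i < length p" for i
    using that by (simp add: part_def)
  show ?thesis
  proof (cases "s \<le> part p s")
    case True
    then have "s \<le> length p" using assms(2) by (auto simp: part_def split: if_splits)
    moreover have "s \<le> part p (Suc i)" if "i < s" for i
      using True part_antimono[OF assms(1), of "Suc i" s] that by simp
    ultimately have "{..<s} \<subseteq> ?A" by (auto simp: nth)
    then have "s \<le> card ?A" using card_mono[of ?A "{..<s}"] by simp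
    then show ?thesis using True len by simp
  next
    case False
    have "?A \<subseteq> {..<s - 1}"
    proof
      fix i assume "i \<in> ?A"
      then have "s \<le> part p (Suc i)" using nth[of i] by simp
      then have "\<not> s \<le> Suc i" using part_antimono[OF assms, of "Suc i"] False by linarith
      then show "i \<in> {..<s - 1}" by auto
    qed
    then have "card ?A \<le> s - 1" using card_mono[of "{..<s - 1}" ?A] by simp
    then show ?thesis using False len assms(2) by simp
  qed
qed

lemma le_durfee_iff:
  assumes "is_partition p" "1 \<le> i"
  shows "i \<le> durfee p \<longleftrightarrow> i \<le> part p i"
proof -
  let ?S = "{s. s \<le> length (filter (\<lambda>x. s \<le> x) p)}"
  have "0 \<in> ?S" by simp
  then have mem: "durfee p \<in> ?S"
    unfolding durfee_def using Max_in[OF durfee_set_finite] by blast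
  show ?thesis
  proof
    assume le: "i \<le> durfee p"
    then have "durfee p \<le> part p (durfee p)"
      using mem le_length_filter_iff[OF assms(1), of "durfee p"] assms(2) by simp
    then show "i \<le> part p i" using part_antimono[OF assms le] le by linarith
  next
    assume "i \<le> part p i"
    then show "i \<le> durfee p"
      unfolding durfee_def
      using le_length_filter_iff[OF assms] Max_ge[OF durfee_set_finite] by blast
  qed
qed

lemma bead_pos_iff:
  assumes "is_partition p" "1 \<le> i"
  shows "0 < bead p i \<longleftrightarrow> i \<le> durfee p"
  using le_durfee_iff[OF assms] by (auto simp: bead_def)

lemma durfee_le_length: "durfee p \<le> length p"
proof -
  have "durfee p \<in> {s. s \<le> length (filter (\<lambda>x. s \<le> x) p)}"
    unfolding durfee_def by (rule Max_in[OF durfee_set_finite]) auto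
  then show ?thesis using length_filter_le order_trans by blast
qed

lemma mem_MD_iff:
  assumes "is_partition p" "self_conjugate p"
  shows "h \<in> MD p \<longleftrightarrow> 0 < h \<and> (\<exists>i\<ge>1. bead p i = int h)"
proof -
  have diag: "int (hook p i i) = bead p i" if "1 \<le> i" "i \<le> durfee p" for i
    using that le_durfee_iff[OF assms(1) that(1)] hook_eq[OF assms(2), of i i]
    by (simp add: young_iff)
  show ?thesis
  proof
    assume "h \<in> MD p"
    then obtain i where "h = hook p i i" "1 \<le> i" "i \<le> durfee p" by (auto simp: MD_def)
    then show "0 < h \<and> (\<exists>i\<ge>1. bead p i = int h)"
      using diag[of i] by (auto simp: hook_def)
  next
    assume "0 < h \<and> (\<exists>i\<ge>1. bead p i = int h)"
    then obtain i where "0 < h" "1 \<le> i" "bead p i = int h" by blast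
    moreover from this have "i \<le> durfee p" using bead_pos_iff[OF assms(1), of i] by simp
    ultimately show "h \<in> MD p" using diag[of i] by (auto simp: MD_def)
  qed
qed

text \<open>Odd integers label the steps of the boundary path of the diagram. Vertical steps are the
  beads of the rows, and conjugation turns a horizontal step at \<open>x\<close> into a vertical one
  at \<open>- x\<close>.\<close>

lemma bead_or_uminus_bead:
  assumes "is_partition p" "self_conjugate p" "odd (x :: int)"
  shows "\<exists>i\<ge>1. bead p i = x \<or> bead p i = - x"
proof (cases "\<exists>i\<ge>1. bead p i = x")
  case False
  obtain c where c: "x = 2 * c + 1" using assms(3) by (elim oddE)
  \<comment> \<open>Any row far enough below the diagram works: its part is 0, so its bead falls
    below \<open>- \<bar>x\<bar>\<close>.\<close>
  have "bead p (length p + nat \<bar>x\<bar> + 1) < x" by (simp add: bead_def part_def)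
  then have ex: "\<exists>k. bead p (Suc k) < x" by auto
  define k where "k = (LEAST k. bead p (Suc k) < x)"
  have k: "bead p (Suc k) < x" unfolding k_def using ex by (rule LeastI_ex)
  have above: "x < bead p k" if k1: "1 \<le> k"
  proof -
    obtain m where m: "k = Suc m" using k1 by (cases k) auto
    then have "\<not> bead p (Suc m) < x" using not_less_Least[of m "\<lambda>k. bead p (Suc k) < x"] k_def by auto
    moreover have "bead p k \<noteq> x" using False k1 by blast
    ultimately show ?thesis using m by simp
  qed
  text \<open>\<open>k\<close> counts the terms above \<open>x\<close>; column \<open>j\<close> is the one with exactly \<open>k\<close> boxes.\<close>
  define j where "j = nat (int k + c + 1)"
  \<comment> \<open>Parts are nonnegative, so this bound also makes \<open>int k + c + 1\<close>
    positive, and \<open>nat\<close> loses nothing.\<close>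
  have "int (part p (Suc k)) < int k + c + 1" using k c by (simp add: bead_def)
  then have j: "int j = int k + c + 1" "1 \<le> j" "part p (Suc k) < j" by (auto simp: j_def)
  have "\<not> Suc k \<le> part p j" using self_conjugate_part[OF assms(2), of "Suc k" j] j by simp
  moreover have "k \<le> part p j"
  proof (cases "1 \<le> k")
    case True
    have "j \<le> part p k" using above[OF True] c j(1) by (simp add: bead_def)
    then show ?thesis using self_conjugate_part[OF assms(2) True j(2)] by simp
  qed simp
  ultimately have "part p j = k" by simp
  then have "bead p j = - x" using j(1) c by (simp add: bead_def)
  then show ?thesis using j(2) by blast
qed blast

text \<open>Beads of rows \<open>i < j\<close> differ by twice the drop in parts plus
  \<open>2 * (j - i)\<close>. Equal parts in neighbouring rows thus give a gap of exactly 2, and any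
  strict drop gives at least 4.\<close>

lemma distinct_take_durfee_iff:
  assumes "is_partition p" "self_conjugate p"
  shows "distinct (take (durfee p) p) \<longleftrightarrow>
    (\<forall>h1 \<in> MD p. \<forall>h2 \<in> MD p. h1 > h2 \<longrightarrow> h1 - h2 \<ge> 4)"
proof
  assume dist: "distinct (take (durfee p) p)"
  show "\<forall>h1 \<in> MD p. \<forall>h2 \<in> MD p. h1 > h2 \<longrightarrow> h1 - h2 \<ge> 4"
  proof (intro ballI impI)
    fix h1 h2 assume h: "h1 \<in> MD p" "h2 \<in> MD p" "h1 > h2"
    obtain i j where ij: "1 \<le> i" "bead p i = int h1" "1 \<le> j" "bead p j = int h2" "0 < h2"
      using h(1,2) mem_MD_iff[OF assms] by auto
    have less: "i < j" using bead_less_iff[OF assms(1) ij(1,3)] ij h(3) by simp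
    have jd: "j \<le> durfee p" using bead_pos_iff[OF assms(1) ij(3)] ij by simp
    have "take (durfee p) p ! (i - 1) \<noteq> take (durfee p) p ! (j - 1)"
      using dist less jd ij(1) durfee_le_length[of p] by (subst nth_eq_iff_index_eq) auto
    then have "part p i \<noteq> part p j"
      using less jd ij(1) durfee_le_length[of p] by (simp add: part_def)
    then have "part p j < part p i" using part_antimono[OF assms(1) ij(1), of j] less by simp
    then show "h1 - h2 \<ge> 4" using ij(2,4) less by (simp add: bead_def)
  qed
next
  assume gap: "\<forall>h1 \<in> MD p. \<forall>h2 \<in> MD p. h1 > h2 \<longrightarrow> h1 - h2 \<ge> 4"
  have step: "part p (Suc i) < part p i" if i: "1 \<le> i" "Suc i \<le> durfee p" for i
  proof -
    have pos: "0 < bead p i" "0 < bead p (Suc i)"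
      using bead_pos_iff[OF assms(1)] i by simp_all
    then have "nat (bead p i) \<in> MD p" "nat (bead p (Suc i)) \<in> MD p"
      using i(1) by (auto simp: mem_MD_iff[OF assms])
    moreover have "nat (bead p (Suc i)) < nat (bead p i)"
      using bead_less_iff[OF assms(1) i(1), of "Suc i"] pos by simp
    ultimately have "nat (bead p i) - nat (bead p (Suc i)) \<ge> 4" using gap by blast
    then show ?thesis using pos by (simp add: bead_def)
  qed
  have "p ! i \<noteq> p ! j" if "i < j" "j < durfee p" for i j
  proof -
    have "part p (Suc j) \<le> part p (Suc (Suc i))"
      using part_antimono[OF assms(1)] that by simp
    also have "\<dots> < part p (Suc i)" using step[of "Suc i"] that by simp
    finally show ?thesis using that durfee_le_length[of p] by (simp add: part_def)
  qed
  then show "distinct (take (durfee p) p)"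
    unfolding distinct_conv_nth by (auto simp: neq_iff)
qed

section \<open>Core conditions in terms of diagonal hooks\<close>

text \<open>The rows \<open>i\<close> and \<open>j\<close> of the two diagonal hooks, possibly
  equal, would meet in a box \<open>(i, j)\<close> of hook length \<open>t\<close>.\<close>

lemma core_MD_sum:
  assumes "is_partition p" "self_conjugate p" "is_core t p" "h1 \<in> MD p" "h2 \<in> MD p"
  shows "h1 + h2 \<noteq> 2 * t"
proof
  assume sum: "h1 + h2 = 2 * t"
  obtain i j where ij: "1 \<le> i" "bead p i = int h1" "1 \<le> j" "bead p j = int h2" "0 < h2"
    using assms(4,5) mem_MD_iff[OF assms(1,2)] by auto
  then have "bead p i + bead p j = 2 * int t" "0 < bead p i + bead p j" using sum by simp_all
  then show False using assms(3) ij(1,3) unfolding is_core_iff_bead[OF assms(2)] by force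
qed

lemma core_MD_diff:
  assumes "is_partition p" "self_conjugate p" "is_core t p" "0 < t" "h \<in> MD p" "2 * t < h"
  shows "h - 2 * t \<in> MD p"
proof -
  obtain i where i: "1 \<le> i" "bead p i = int h" using assms(5) mem_MD_iff[OF assms(1,2)] by auto
  have "odd (int h - 2 * int t)" using odd_bead[of p i] i(2) by simp
  then obtain j where j: "1 \<le> j" "bead p j = int h - 2 * int t \<or> bead p j = - (int h - 2 * int t)"
    using bead_or_uminus_bead[OF assms(1,2)] by blast
  have "bead p j \<noteq> - (int h - 2 * int t)"
  proof
    assume "bead p j = - (int h - 2 * int t)"
    then have "bead p i + bead p j = 2 * int t" using i(2) by simp
    then show False
      using assms(3,4) i(1) j(1) unfolding is_core_iff_bead[OF assms(2)] by force
  qed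
  then show ?thesis using j assms(6) by (auto simp: mem_MD_iff[OF assms(1,2)])
qed

text \<open>A converse of \<open>core_MD_sum\<close>: with all beads below \<open>2 * t\<close>, the
  only positive multiple of \<open>2 * t\<close> that a sum of two beads can reach is
  \<open>2 * t\<close> itself.\<close>

lemma is_core_if_MD_sum:
  assumes "is_partition p" "self_conjugate p"
    and bound: "\<And>h. h \<in> MD p \<Longrightarrow> h < 2 * t"
    and sum: "\<And>h1 h2. h1 \<in> MD p \<Longrightarrow> h2 \<in> MD p \<Longrightarrow> h1 + h2 \<noteq> 2 * t"
  shows "is_core t p"
  unfolding is_core_iff_bead[OF assms(2)]
proof (intro allI impI notI)
  fix i j :: nat
  assume i: "1 \<le> i" and j: "1 \<le> j" and pos: "0 < bead p i + bead p j"
    and dvd: "2 * int t dvd bead p i + bead p j"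
  have MD: "nat (bead p k) \<in> MD p" if "1 \<le> k" "0 < bead p k" for k
    using that by (auto simp: mem_MD_iff[OF assms(1,2)])
  have less: "bead p k < 2 * int t" if "1 \<le> k" "0 < bead p k" for k
    using bound[OF MD[OF that]] by simp
  have ge: "2 * int t \<le> bead p i + bead p j" using dvd pos by (rule zdvd_imp_le)
  \<comment> \<open>If one bead were not positive, the other would have to be at least
    \<open>2 * t\<close>.\<close>
  have "0 < bead p i" "0 < bead p j" using less[OF i] less[OF j] ge pos by linarith+
  note pos' = this
  obtain m where m: "bead p i + bead p j = 2 * int t * m" using dvd by (elim dvdE)
  have "2 * int t * m < 2 * int t * 2" using less[OF i pos'(1)] less[OF j pos'(2)] m by linarith
  moreover have "2 * int t * 0 < 2 * int t * m" using pos m by simp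
  ultimately have "m = 1" by (simp add: mult_less_cancel_left zero_less_mult_iff)
  then have "nat (bead p i) + nat (bead p j) = 2 * t" using m pos' by simp
  then show False using sum[OF MD[OF i pos'(1)] MD[OF j pos'(2)]] by simp
qed

theorem theorem2p4:
  fixes t :: nat and p :: "nat list"
  assumes "t > 0" and "is_partition p" and "self_conjugate p"
  shows "p \<in> DS t \<longleftrightarrow>
    MD p \<subseteq> Q t \<and>
    (\<forall>h1 \<in> MD p. \<forall>h2 \<in> MD p. h1 > h2 \<longrightarrow> h1 - h2 \<ge> 4) \<and>
    (\<forall>h1 \<in> MD p. \<forall>h2 \<in> MD p. h1 + h2 \<noteq> 2 * t \<and> h1 + h2 \<noteq> 2 * t + 2)"
    (is "_ \<longleftrightarrow> ?Q \<and> ?gap \<and> ?sum")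
proof
  assume "p \<in> DS t"
  then have core: "is_core t p" "is_core (t + 1) p" and gap: ?gap
    using distinct_take_durfee_iff[OF assms(2,3)] by (auto simp: DS_def)
  have sum: ?sum
    using core_MD_sum[OF assms(2,3) core(1)] core_MD_sum[OF assms(2,3) core(2)] by simp
  have "h \<in> Q t" if h: "h \<in> MD p" for h
  proof -
    have pos: "0 < h" and odd: "odd h"
      using h mem_MD_iff[OF assms(2,3)] odd_bead[of p] by (auto, metis even_of_nat)
    \<comment> \<open>Pairing \<open>h\<close> with itself removes \<open>t\<close> and
      \<open>t + 1\<close>.\<close>
    have "h + h \<noteq> 2 * t" "h + h \<noteq> 2 * t + 2" using sum h by blast+
    then have "h \<noteq> t" "h \<noteq> t + 1" by auto
    moreover have "\<not> 2 * t + 2 < h"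
    proof
      assume big: "2 * t + 2 < h"
      then have "h - 2 * t \<in> MD p" "h - 2 * (t + 1) \<in> MD p"
        using core_MD_diff[OF assms(2,3) core(1) assms(1) h]
          core_MD_diff[OF assms(2,3) core(2) _ h] by simp_all
      moreover have "h - 2 * (t + 1) < h - 2 * t" using big by simp
      ultimately have "(h - 2 * t) - (h - 2 * (t + 1)) \<ge> 4" using gap by blast
      then show False by simp
    qed
    moreover have "h \<noteq> 2 * t + 1"
    proof
      assume eq: "h = 2 * t + 1"
      then have "1 \<in> MD p" using core_MD_diff[OF assms(2,3) core(1) assms(1) h] by simp
      then show False using sum h eq by force
    qed
    \<comment> \<open>Parity excludes the remaining values above \<open>2 * t - 1\<close>.\<close>
    moreover have "h \<noteq> 2 * t" "h \<noteq> 2 * t + 2" using odd by auto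
    ultimately show ?thesis using pos odd by (auto simp: Q_def)
  qed
  then show "?Q \<and> ?gap \<and> ?sum" using gap sum by blast
next
  assume R: "?Q \<and> ?gap \<and> ?sum"
  have bound: "h < 2 * t" if "h \<in> MD p" for h
    using R that assms(1) by (auto simp: Q_def)
  have "is_core t p"
    using R bound by (intro is_core_if_MD_sum[OF assms(2,3)]) auto
  moreover have "is_core (t + 1) p"
    using R bound by (intro is_core_if_MD_sum[OF assms(2,3)]) (auto simp: less_SucI)
  ultimately show "p \<in> DS t"
    using R assms(2,3) distinct_take_durfee_iff[OF assms(2,3)] by (simp add: DS_def)
qed

end
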